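(* Let $s,t$ be positive integers and let $M$ be an $(s,t)$-spike of order $m\ge s+t$. Then there is a sequence of matroids $M_0,M_1,\dots,M_{s+t-2}$ with $M_{s+t-2}=M$ such that $M_0$ is a $(1,1)$-spike of order $m$, for each $i\in\{1,\dots,t-1\}$ the matroid $M_i$ is obtained from $M_{i-1}$ by a quotient step, and for each $i\in\{t,\dots,s+t-2\}$ the matroid $M_i$ is obtained from $M_{i-1}$ by a dual step. (That is, $M$ is obtained from a $(1,1)$-spike of order $m$ by applying the quotient step $t-1$ times followed by the dual step $s-1$ times.)
   Context: For positive integers $s,t$, an $(s,t)$-spike of order $m$ is a matroid $N$ with $m\ge\max\{s,t\}$ together with an associated partition $(A_1,\dots,A_m)$ of $E(N)$ into $2$-element sets (arms) such that the union of any $s$ arms is a circuit of $N$ and the union of any $t$ arms is a cocircuit of $N$. Quotient step: let $N$ be an $(s',t')$-spike of order $m\ge s'+t'$ with associated partition $(A_1,\dots,A_m)$; let $N+e$ be a single-element extension of $N$ by a new element $e$ such that, for every cocircuit $C^*$ of $N$ that is the union of $t'$ arms, $e\notin \mathrm{cl}_{N+e}(E(N)-C^* )$; the matroid $(N+e)/e$ is said to be obtained from $N$ by a quotient step. Dual step: for an $(s',t')$-spike $N$ of order $m\ge s'+t'$, the dual $N^*$ is a $(t',s')$-spike of order $m$ with the same associated partition; if $N''$ is obtained from $N^*$ by a quotient step, then $(N'')^*$ is said to be obtained from $N$ by a dual step. *)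

theory Defs
  imports Main "HOL-Library.Disjoint_Sets"
begin

record 'a indep_system =
  ground :: "'a set"
  indep :: "'a set \<Rightarrow> bool"

text \<open>Only subsets of the ground set are independent, so equality of records is equality of
  matroids.\<close>

locale matroid =
  fixes M :: "'a indep_system"
  assumes finite_ground: "finite (ground M)"
    and indep_subset_ground: "indep M X \<Longrightarrow> X \<subseteq> ground M"
    and indep_empty: "indep M {}"
    and indep_subset: "indep M X \<Longrightarrow> Y \<subseteq> X \<Longrightarrow> indep M Y"
    and indep_augment: "indep M X \<Longrightarrow> indep M Y \<Longrightarrow> card X < card Y \<Longrightarrow>
      \<exists>y\<in>Y - X. indep M (insert y X)"

definition basis :: "'a indep_system \<Rightarrow> 'a set \<Rightarrow> bool" where
  "basis M B \<longleftrightarrow> indep M B \<and> (\<forall>X. indep M X \<and> B \<subseteq> X \<longrightarrow> X = B)"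

definition circuit :: "'a indep_system \<Rightarrow> 'a set \<Rightarrow> bool" where
  "circuit M C \<longleftrightarrow> C \<subseteq> ground M \<and> \<not> indep M C \<and> (\<forall>D. D \<subset> C \<longrightarrow> indep M D)"

definition mrank :: "'a indep_system \<Rightarrow> 'a set \<Rightarrow> nat" where
  "mrank M X = Max {card I | I. I \<subseteq> X \<and> indep M I}"

definition mclosure :: "'a indep_system \<Rightarrow> 'a set \<Rightarrow> 'a set" where
  "mclosure M X = {x \<in> ground M. mrank M (insert x X) = mrank M X}"

definition dual_matroid :: "'a indep_system \<Rightarrow> 'a indep_system" where
  "dual_matroid M =
     \<lparr>ground = ground M, indep = (\<lambda>X. X \<subseteq> ground M \<and> (\<exists>B. basis M B \<and> X \<subseteq> ground M - B))\<rparr>"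

definition cocircuit :: "'a indep_system \<Rightarrow> 'a set \<Rightarrow> bool" where
  "cocircuit M C \<longleftrightarrow> circuit (dual_matroid M) C"

definition delete :: "'a indep_system \<Rightarrow> 'a set \<Rightarrow> 'a indep_system" where
  "delete M D = \<lparr>ground = ground M - D, indep = (\<lambda>X. indep M X \<and> X \<inter> D = {})\<rparr>"

definition contract :: "'a indep_system \<Rightarrow> 'a set \<Rightarrow> 'a indep_system" where
  "contract M D = dual_matroid (delete (dual_matroid M) D)"

definition relabel :: "('a \<Rightarrow> 'b) \<Rightarrow> 'a indep_system \<Rightarrow> 'b indep_system" where
  "relabel f M = \<lparr>ground = f ` ground M, indep = (\<lambda>X. \<exists>Y. indep M Y \<and> X = f ` Y)\<rparr>"

definition single_element_extension :: "'a indep_system \<Rightarrow> 'a \<Rightarrow> 'a indep_system \<Rightarrow> bool" where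
  "single_element_extension N e N_e \<longleftrightarrow>
     matroid N_e \<and> e \<notin> ground N \<and> ground N_e = insert e (ground N) \<and> delete N_e {e} = N"

definition spike ::
  "nat \<Rightarrow> nat \<Rightarrow> nat \<Rightarrow> 'a set set \<Rightarrow> 'a indep_system \<Rightarrow> bool" where
  "spike s t m \<A> N \<longleftrightarrow>
     matroid N \<and> s \<ge> 1 \<and> t \<ge> 1 \<and> m \<ge> max s t \<and>
     partition_on (ground N) \<A> \<and> card \<A> = m \<and> (\<forall>A\<in>\<A>. card A = 2) \<and>
     (\<forall>J. J \<subseteq> \<A> \<and> card J = s \<longrightarrow> circuit N (\<Union>J)) \<and>
     (\<forall>J. J \<subseteq> \<A> \<and> card J = t \<longrightarrow> cocircuit N (\<Union>J))"

text \<open>The type \<open>'a\<close> may have no element outside the ground set of \<open>N\<close>. The extension therefore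
  lives on \<open>'a option\<close>: an old element \<open>x\<close> appears as \<open>Some x\<close>, and the new element \<open>e\<close>
  is \<open>None\<close>. Its name is immaterial, since it is contracted again; the result \<open>N'\<close> is again
  a matroid on the ground set of \<open>N\<close>.\<close>

definition quotient_step_wrt ::
  "nat \<Rightarrow> nat \<Rightarrow> nat \<Rightarrow> 'a set set \<Rightarrow> 'a indep_system \<Rightarrow> 'a indep_system \<Rightarrow> bool" where
  "quotient_step_wrt s t m \<A> N N' \<longleftrightarrow>
     spike s t m \<A> N \<and> m \<ge> s + t \<and>
     (\<exists>N_e :: 'a option indep_system.
        single_element_extension (relabel Some N) None N_e \<and>
        (\<forall>C. cocircuit N C \<and> (\<exists>J. J \<subseteq> \<A> \<and> card J = t \<and> C = \<Union>J) \<longrightarrow>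
             None \<notin> mclosure N_e (Some ` (ground N - C))) \<and>
        relabel Some N' = contract N_e {None})"

definition quotient_step :: "'a indep_system \<Rightarrow> 'a indep_system \<Rightarrow> bool" where
  "quotient_step N N' \<longleftrightarrow> (\<exists>s t m \<A>. quotient_step_wrt s t m \<A> N N')"

definition dual_step :: "'a indep_system \<Rightarrow> 'a indep_system \<Rightarrow> bool" where
  "dual_step N N' \<longleftrightarrow>
     (\<exists>s t m \<A> N''. spike s t m \<A> N \<and> m \<ge> s + t \<and>
        quotient_step_wrt t s m \<A> (dual_matroid N) N'' \<and> N' = dual_matroid N'')"

end

theory Submission
  imports Defs
begin

text \<open>The proof peels steps off \<open>M\<close>. In an \<open>(s,t)\<close>-spike of order \<open>m \<ge> s + t\<close>, orthogonality with
  the \<open>t\<close>-arm cocircuits forces every circuit that avoids \<open>t - 1\<close> arms to be a union of \<open>s\<close> arms.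
  Hence the \<open>s\<close>-arm unions form a linear class of circuits: a circuit contained in the union of
  two of them of nullity two lies inside \<open>s + 1\<close> arms, so it avoids \<open>m - s - 1 \<ge> t - 1\<close> arms.
  A linear class determines an elementary lift: its independent sets are the sets of nullity at
  most one in \<open>M\<close> that contain no \<open>s\<close> arms. For \<open>t \<ge> 2\<close> this lift is an \<open>(s, t - 1)\<close>-spike, and \<open>M\<close>
  is obtained from it by a quotient step. Duality turns this into the statement that an
  \<open>(s,t)\<close>-spike with \<open>s \<ge> 2\<close> is obtained from an \<open>(s - 1, t)\<close>-spike by a dual step.\<close>

section \<open>Matroids\<close>

context matroid
begin

section \<open>Bases, circuits and augmentation\<close>

lemma finite_indep: "indep M X \<Longrightarrow> finite X"
  using finite_ground indep_subset_ground finite_subset by blast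

lemma indep_extend:
  assumes "indep M I" "indep M B"
  shows "\<exists>J. I \<subseteq> J \<and> J \<subseteq> I \<union> B \<and> indep M J \<and> card B \<le> card J"
  using assms
proof (induction "card B - card I" arbitrary: I rule: less_induct)
  case less
  show ?case
  proof (cases "card B \<le> card I")
    case True
    then show ?thesis using less.prems by blast
  next
    case False
    then obtain y where y: "y \<in> B - I" "indep M (insert y I)"
      using indep_augment[of I B] less.prems by auto
    have "card B - card (insert y I) < card B - card I"
      using y False finite_indep[OF less.prems(1)] by auto
    from less.hyps[OF this y(2) less.prems(2)] show ?thesis using y by blast
  qed
qed

lemma basis_indep: "basis M B \<Longrightarrow> indep M B"
  by (simp add: basis_def)

lemma card_indep_le_basis:
  assumes "basis M B" "indep M I"
  shows "card I \<le> card B"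
proof -
  obtain J where "B \<subseteq> J" "indep M J" "card I \<le> card J"
    using indep_extend[of B I] assms by (auto simp: basis_def)
  then show ?thesis using assms by (auto simp: basis_def)
qed

lemma basisI_card:
  assumes "indep M B" "\<And>I. indep M I \<Longrightarrow> card I \<le> card B"
  shows "basis M B"
  unfolding basis_def using assms finite_indep by (metis card_seteq)

lemma ex_basis: "\<exists>B. basis M B"
proof -
  have "finite {B. indep M B}"
    by (rule finite_subset[of _ "Pow (ground M)"]) (auto dest: indep_subset_ground simp: finite_ground)
  moreover have "{B. indep M B} \<noteq> {}" using indep_empty by blast
  ultimately obtain B where "indep M B" "\<And>I. indep M I \<Longrightarrow> B \<subseteq> I \<Longrightarrow> I = B"
    using finite_has_maximal[of "{B. indep M B}"] by blast
  then show ?thesis unfolding basis_def by blast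
qed

lemma indep_extend_basis:
  assumes "indep M I" "basis M B"
  shows "\<exists>J. I \<subseteq> J \<and> J \<subseteq> I \<union> B \<and> basis M J"
proof -
  obtain J where "I \<subseteq> J" "J \<subseteq> I \<union> B" "indep M J" "card B \<le> card J"
    using indep_extend[of I B] assms basis_indep by blast
  then show ?thesis using basisI_card card_indep_le_basis[OF assms(2)] by (meson le_trans)
qed

lemma indep_iff_subset_basis: "indep M I \<longleftrightarrow> (\<exists>B. basis M B \<and> I \<subseteq> B)"
  using ex_basis indep_extend_basis indep_subset basis_indep by meson

lemma dependent_contains_circuit:
  assumes "X \<subseteq> ground M" "\<not> indep M X"
  shows "\<exists>C\<subseteq>X. circuit M C"
proof -
  have "finite {D. D \<subseteq> X \<and> \<not> indep M D}"
    by (rule finite_subset[of _ "Pow (ground M)"]) (use assms finite_ground in auto)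
  moreover have "{D. D \<subseteq> X \<and> \<not> indep M D} \<noteq> {}" using assms by blast
  ultimately obtain C where "C \<subseteq> X" "\<not> indep M C"
    and min: "\<forall>D\<in>{D. D \<subseteq> X \<and> \<not> indep M D}. D \<subseteq> C \<longrightarrow> C = D"
    using finite_has_minimal[of "{D. D \<subseteq> X \<and> \<not> indep M D}"] by auto
  moreover have "indep M D" if "D \<subset> C" for D
    using that min \<open>C \<subseteq> X\<close> by auto
  ultimately have "C \<subseteq> X \<and> circuit M C" unfolding circuit_def using assms(1) by simp
  then show ?thesis by blast
qed

lemma circuit_not_subset_indep: "circuit M C \<Longrightarrow> indep M I \<Longrightarrow> \<not> C \<subseteq> I"
  unfolding circuit_def using indep_subset by blast

lemma circuit_subset_eq: "circuit M C \<Longrightarrow> circuit M D \<Longrightarrow> C \<subseteq> D \<Longrightarrow> C = D"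
  unfolding circuit_def by blast

lemma indep_circuit_minus: "circuit M C \<Longrightarrow> c \<in> C \<Longrightarrow> indep M (C - {c})"
  unfolding circuit_def by blast

text \<open>If some \<open>z\<close> lay in \<open>C\<close> but not in \<open>D\<close>, then
  \<open>C - {z}\<close> would extend inside \<open>C - {z}\<close> and \<open>I\<close> to an
  independent \<open>J\<close> at least as large as \<open>I\<close>. Such a \<open>J\<close> misses
  \<open>z\<close>, since otherwise it contains \<open>C\<close>, so by size it is all of
  \<open>insert x I - {z}\<close> and contains \<open>D\<close>. This uniqueness of fundamental
  circuits drives every exchange argument below.\<close>

lemma circuit_in_insert_unique:
  assumes I: "indep M I" and C: "circuit M C" "C \<subseteq> insert x I" and D: "circuit M D" "D \<subseteq> insert x I"
  shows "C = D"
proof (rule ccontr)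
  assume "C \<noteq> D"
  then obtain z where z: "z \<in> C" "z \<notin> D" using circuit_subset_eq C D by blast
  have x: "x \<notin> I" using C I circuit_not_subset_indep by (metis insert_absorb)
  obtain J where J: "C - {z} \<subseteq> J" "J \<subseteq> (C - {z}) \<union> I" "indep M J" "card I \<le> card J"
    using indep_extend[OF indep_circuit_minus[OF C(1) z(1)] I] by blast
  have "z \<notin> J" using J C(1) circuit_not_subset_indep by blast
  then have sub: "J \<subseteq> insert x I - {z}" using J C by blast
  have "z \<in> insert x I" using z C by blast
  then have "card (insert x I - {z}) = card I" using x finite_indep[OF I] by simp
  then have "J = insert x I - {z}"
    using sub J(4) finite_indep[OF I] by (metis card_seteq finite_Diff finite_insert)
  then have "D \<subseteq> J" using D z by blast
  then show False using D(1) J(3) circuit_not_subset_indep by blast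
qed

section \<open>Duality, and orthogonality of circuits and cocircuits\<close>

lemma ground_dual: "ground (dual_matroid M) = ground M"
  by (simp add: dual_matroid_def)

lemma indep_dual_iff:
  "indep (dual_matroid M) X \<longleftrightarrow> X \<subseteq> ground M \<and> (\<exists>B. basis M B \<and> X \<inter> B = {})"
  unfolding dual_matroid_def by auto

lemma matroid_dual: "matroid (dual_matroid M)"
proof
  show "finite (ground (dual_matroid M))" by (simp add: ground_dual finite_ground)
  show "indep (dual_matroid M) {}" using ex_basis by (simp add: indep_dual_iff)
next
  fix X Y
  assume "indep (dual_matroid M) X" "indep (dual_matroid M) Y" and less: "card X < card Y"
  then obtain BX BY where X: "X \<subseteq> ground M" "basis M BX" "X \<inter> BX = {}"
    and Y: "Y \<subseteq> ground M" "basis M BY" "Y \<inter> BY = {}" by (auto simp: indep_dual_iff)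
  \<comment> \<open>The new basis should avoid \<open>X\<close> and keep as much of
    \<open>BY\<close> as possible: both \<open>BY - X\<close> and \<open>BX\<close> are disjoint
    from \<open>X\<close>, so \<open>B\<close> is too. Any element of \<open>Y - X\<close> outside
    \<open>B\<close> can then be added to \<open>X\<close>.\<close>
  have "indep M (BY - X)" using Y basis_indep indep_subset by blast
  then obtain B where B: "BY - X \<subseteq> B" "B \<subseteq> (BY - X) \<union> BX" "basis M B"
    using indep_extend_basis[OF _ X(2)] by metis
  have fin: "finite X" "finite Y" "finite B" "finite BY"
    using finite_subset[OF X(1) finite_ground] finite_subset[OF Y(1) finite_ground]
      finite_indep[OF basis_indep[OF B(3)]] finite_indep[OF basis_indep[OF Y(2)]] by simp_all
  have "\<exists>y\<in>Y - X. y \<notin> B"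
  proof (rule ccontr)
    assume "\<not> ?thesis"
    \<comment> \<open>The contradiction is a count: \<open>B\<close> would have at least
      \<open>card (BY - X) + card (Y - X)\<close> elements, while \<open>card BY\<close> is at most
      \<open>card (BY - X) + card (X - Y)\<close>, which is smaller; but bases have equal
      size.\<close>
    then have "(BY - X) \<union> (Y - X) \<subseteq> B" using B by blast
    then have "card ((BY - X) \<union> (Y - X)) \<le> card B" using fin card_mono by blast
    moreover have "card ((BY - X) \<union> (Y - X)) = card (BY - X) + card (Y - X)"
      using Y fin by (intro card_Un_disjoint) auto
    moreover have "card BY = card (BY - X) + card (BY \<inter> X)"
      using fin card_Int_Diff[of BY X] by simp
    moreover have "card (BY \<inter> X) \<le> card (X - Y)"
      using Y fin by (intro card_mono) auto
    moreover have "card (X - Y) < card (Y - X)"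
      using less fin by (metis card_less_sym_Diff)
    moreover have "card B = card BY"
      using card_indep_le_basis B Y basis_indep by (meson le_antisym)
    ultimately show False by linarith
  qed
  then obtain y where "y \<in> Y - X" "y \<notin> B" by blast
  moreover from this have "indep (dual_matroid M) (insert y X)"
    unfolding indep_dual_iff using X Y B by blast
  ultimately show "\<exists>y\<in>Y - X. indep (dual_matroid M) (insert y X)" by blast
qed (auto simp: indep_dual_iff ground_dual)

lemma basis_subset_ground: "basis M B \<Longrightarrow> B \<subseteq> ground M"
  using basis_indep indep_subset_ground by blast

lemma basis_dual_compl:
  assumes "basis M B"
  shows "basis (dual_matroid M) (ground M - B)"
  unfolding basis_def
proof (intro conjI allI impI)
  show "indep (dual_matroid M) (ground M - B)" using assms by (auto simp: indep_dual_iff)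
  fix X
  assume X: "indep (dual_matroid M) X \<and> ground M - B \<subseteq> X"
  then obtain B' where B': "basis M B'" "X \<inter> B' = {}" "X \<subseteq> ground M" by (auto simp: indep_dual_iff)
  then have "B' \<subseteq> B" using X basis_subset_ground by blast
  then have "B' = B" using B' assms unfolding basis_def by blast
  then show "X = ground M - B" using B' X by blast
qed

lemma basis_dual_iff:
  "basis (dual_matroid M) X \<longleftrightarrow> (\<exists>B. basis M B \<and> X = ground M - B)"
proof
  assume X: "basis (dual_matroid M) X"
  then obtain B where B: "basis M B" "X \<inter> B = {}" "X \<subseteq> ground M"
    by (auto simp: basis_def indep_dual_iff)
  then have "indep (dual_matroid M) (ground M - B)" "X \<subseteq> ground M - B"
    by (auto simp: indep_dual_iff)
  then show "\<exists>B. basis M B \<and> X = ground M - B" using X B unfolding basis_def by blast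
qed (auto intro: basis_dual_compl)

lemma dual_dual: "dual_matroid (dual_matroid M) = M"
proof -
  have "indep (dual_matroid (dual_matroid M)) X \<longleftrightarrow> indep M X" for X
  proof -
    have "indep (dual_matroid (dual_matroid M)) X \<longleftrightarrow>
        X \<subseteq> ground M \<and> (\<exists>B. basis M B \<and> X \<subseteq> ground M - (ground M - B))"
      unfolding dual_matroid_def[of "dual_matroid M"] by (auto simp: basis_dual_iff ground_dual)
    also have "\<dots> \<longleftrightarrow> (\<exists>B. basis M B \<and> X \<subseteq> B)"
      using basis_subset_ground by blast
    finally show ?thesis by (simp add: indep_iff_subset_basis)
  qed
  then have "indep (dual_matroid (dual_matroid M)) = indep M" by blast
  moreover have "ground (dual_matroid (dual_matroid M)) = ground M"
    by (simp add: dual_matroid_def)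
  ultimately show ?thesis by (auto intro: indep_system.equality)
qed

text \<open>A single common element \<open>c\<close> leads to a basis that avoids \<open>D\<close>:
  start from a basis \<open>B\<close> missing \<open>D - {c}\<close> and extend
  \<open>C - {c}\<close> by elements of \<open>B\<close>. The result cannot contain
  \<open>c\<close>, as it would then contain \<open>C\<close>, so \<open>D\<close> would be
  independent in the dual.\<close>

lemma circuit_cocircuit_Int:
  assumes C: "circuit M C" and D: "cocircuit M D"
  shows "C \<inter> D \<noteq> {c}"
proof
  assume CD: "C \<inter> D = {c}"
  have D': "D \<subseteq> ground M" "\<not> indep (dual_matroid M) D" "indep (dual_matroid M) (D - {c})"
  proof -
    have "D - {c} \<subset> D" using CD by blast
    then show "D \<subseteq> ground M" "\<not> indep (dual_matroid M) D" "indep (dual_matroid M) (D - {c})"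
      using D unfolding cocircuit_def circuit_def ground_dual by simp_all
  qed
  then obtain B where B: "basis M B" "(D - {c}) \<inter> B = {}" by (auto simp: indep_dual_iff)
  have "indep M (C - {c})" using C CD indep_circuit_minus by blast
  then obtain J where J: "C - {c} \<subseteq> J" "J \<subseteq> (C - {c}) \<union> B" "basis M J"
    using indep_extend_basis[OF _ B(1)] by metis
  have "c \<notin> J" using J C circuit_not_subset_indep basis_indep by blast
  then have "D \<inter> J = {}" using J B CD by blast
  then show False using D' J by (auto simp: indep_dual_iff)
qed

section \<open>Contraction of a non-loop and a rank criterion\<close>

lemma indep_contract_single:
  assumes e: "indep M {e}"
  shows "indep (contract M {e}) X \<longleftrightarrow> e \<notin> X \<and> indep M (insert e X)"
proof -
  let ?D = "delete (dual_matroid M) {e}"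
  have iff: "indep (contract M {e}) X \<longleftrightarrow> X \<subseteq> ground M - {e} \<and> (\<exists>B0. basis ?D B0 \<and> X \<inter> B0 = {})"
    unfolding contract_def by (subst dual_matroid_def) (auto simp: delete_def ground_dual)
  have iD: "indep ?D Y \<longleftrightarrow> indep (dual_matroid M) Y \<and> e \<notin> Y" for Y
    by (auto simp: delete_def)
  show ?thesis
  proof
    assume "indep (contract M {e}) X"
    then obtain B0 where X: "X \<subseteq> ground M - {e}" and B0: "basis ?D B0" "X \<inter> B0 = {}"
      using iff by blast
    then obtain B where B: "basis M B" "B0 \<inter> B = {}" "B0 \<subseteq> ground M" and "e \<notin> B0"
      by (auto simp: basis_def iD indep_dual_iff)
    \<comment> \<open>Since \<open>{e}\<close> is independent, \<open>B\<close> can be replaced by a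
      basis through \<open>e\<close> whose complement still contains \<open>B0\<close>. Maximality
      of \<open>B0\<close> then makes it equal to that complement.\<close>
    obtain B' where B': "{e} \<subseteq> B'" "B' \<subseteq> {e} \<union> B" "basis M B'"
      using indep_extend_basis[OF e B(1)] by metis
    have "indep ?D (ground M - B')" using B' by (auto simp: iD indep_dual_iff)
    moreover have "B0 \<subseteq> ground M - B'" using B B' \<open>e \<notin> B0\<close> by blast
    ultimately have "B0 = ground M - B'" using B0 unfolding basis_def by blast
    then have "insert e X \<subseteq> B'" using X B0 B' by blast
    then show "e \<notin> X \<and> indep M (insert e X)" using X B' indep_iff_subset_basis by blast
  next
    assume X: "e \<notin> X \<and> indep M (insert e X)"
    then obtain B where B: "basis M B" "insert e X \<subseteq> B" using indep_iff_subset_basis by blast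
    have "basis ?D (ground M - B)"
      using basis_dual_compl[OF B(1)] B(2) by (auto simp: basis_def iD)
    moreover have "X \<subseteq> ground M" using X indep_subset_ground by blast
    ultimately show "indep (contract M {e}) X" unfolding iff using X B by blast
  qed
qed

text \<open>A largest independent subset of \<open>X\<close> stays independent when \<open>e\<close>
  is added. This is the form in which \<open>e\<close> is shown to lie outside the closure of
  \<open>X\<close>.\<close>

lemma mrank_less_insert:
  assumes "X \<subseteq> ground M" "e \<notin> X" "\<And>I. I \<subseteq> X \<Longrightarrow> indep M I \<Longrightarrow> indep M (insert e I)"
  shows "mrank M X < mrank M (insert e X)"
proof -
  have fin: "finite {card I | I. I \<subseteq> Y \<and> indep M I}" for Y
  proof -
    have "finite {I. I \<subseteq> Y \<and> indep M I}"
      by (rule finite_subset[of _ "Pow (ground M)"]) (auto dest: indep_subset_ground simp: finite_ground)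
    then show ?thesis by (simp add: setcompr_eq_image)
  qed
  have "mrank M X \<in> {card I | I. I \<subseteq> X \<and> indep M I}"
    unfolding mrank_def by (rule Max_in) (use fin indep_empty in auto)
  then obtain I where I: "I \<subseteq> X" "indep M I" "mrank M X = card I" by blast
  have "card (insert e I) \<le> mrank M (insert e X)"
    unfolding mrank_def by (rule Max_ge[OF fin]) (use I assms in blast)
  moreover have "card (insert e I) = Suc (card I)" using I assms finite_indep by (auto intro: card_insert_disjoint)
  ultimately show ?thesis using I by simp
qed

end

section \<open>The elementary lift of a spike\<close>

lemma card_vimage_Some:
  assumes "finite X"
  shows "card X = card (Some -` X) + (if None \<in> X then 1 else 0)"
proof -
  have eq: "X - {None} = Some ` (Some -` X)"
  proof
    show "X - {None} \<subseteq> Some ` (Some -` X)"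
    proof
      fix z assume "z \<in> X - {None}"
      then show "z \<in> Some ` (Some -` X)" by (cases z) auto
    qed
  qed auto
  have "card (X - {None}) = card (Some -` X)"
    unfolding eq by (rule card_image) simp
  then show ?thesis using assms card_Suc_Diff1[of X None] by auto
qed

lemma vimage_Some_eq_iff: "None \<notin> X \<Longrightarrow> X = Some ` Y \<longleftrightarrow> Some -` X = Y"
  by (auto simp: image_iff) (metis not_None_eq)

lemma indep_relabel_Some: "indep (relabel Some N) X \<longleftrightarrow> None \<notin> X \<and> indep N (Some -` X)"
proof (cases "None \<in> X")
  case True
  then show ?thesis by (auto simp: relabel_def)
next
  case False
  then show ?thesis using vimage_Some_eq_iff[OF False] by (auto simp: relabel_def)
qed

lemma ground_relabel: "ground (relabel f N) = f ` ground N"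
  by (simp add: relabel_def)

text \<open>The last clause also holds for every independent \<open>X\<close>, with any
  \<open>x\<close>, so nullity zero and nullity one need no separate cases.\<close>

definition lift_indep :: "nat \<Rightarrow> 'a set set \<Rightarrow> 'a indep_system \<Rightarrow> 'a set \<Rightarrow> bool" where
  "lift_indep s \<A> M X \<longleftrightarrow> X \<subseteq> ground M \<and> (\<forall>J\<subseteq>\<A>. card J = s \<longrightarrow> \<not> \<Union>J \<subseteq> X) \<and> (\<exists>x. indep M (X - {x}))"

definition lift_matroid :: "nat \<Rightarrow> 'a set set \<Rightarrow> 'a indep_system \<Rightarrow> 'a indep_system" where
  "lift_matroid s \<A> M = \<lparr>ground = ground M, indep = lift_indep s \<A> M\<rparr>"

text \<open>The one-element extension of the lift in which contracting the new element \<open>None\<close> gives back \<open>M\<close>.\<close>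

definition lift_ext :: "nat \<Rightarrow> 'a set set \<Rightarrow> 'a indep_system \<Rightarrow> 'a option indep_system" where
  "lift_ext s \<A> M = \<lparr>ground = insert None (Some ` ground M),
     indep = (\<lambda>X. if None \<in> X then indep M (Some -` X) else lift_indep s \<A> M (Some -` X))\<rparr>"

locale long_spike = matroid M for M :: "'a indep_system" +
  fixes s t m :: nat and \<A> :: "'a set set"
  assumes spike: "spike s t m \<A> M" and long: "s + t \<le> m"
begin

section \<open>Arms of the spike and the linear class formed by their unions\<close>

lemma s_pos: "1 \<le> s" and t_pos: "1 \<le> t"
  and arms_partition: "partition_on (ground M) \<A>" and card_arms: "card \<A> = m"
  and card_arm: "A \<in> \<A> \<Longrightarrow> card A = 2"
  and circuit_arms: "J \<subseteq> \<A> \<Longrightarrow> card J = s \<Longrightarrow> circuit M (\<Union>J)"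
  and cocircuit_arms: "J \<subseteq> \<A> \<Longrightarrow> card J = t \<Longrightarrow> cocircuit M (\<Union>J)"
  using spike unfolding spike_def by auto

lemma finite_arms: "finite \<A>"
  using card_arms s_pos long card.infinite by fastforce

lemma Union_arms: "\<Union>\<A> = ground M"
  using arms_partition by (simp add: partition_on_def)

lemma arms_eq: "A \<in> \<A> \<Longrightarrow> B \<in> \<A> \<Longrightarrow> x \<in> A \<Longrightarrow> x \<in> B \<Longrightarrow> A = B"
  using arms_partition by (auto simp: partition_on_def disjoint_def)

lemma arm_nonempty: "A \<in> \<A> \<Longrightarrow> A \<noteq> {}"
  using card_arm by fastforce

lemma arm_subset_Union: "A \<in> \<A> \<Longrightarrow> J \<subseteq> \<A> \<Longrightarrow> x \<in> A \<Longrightarrow> x \<in> \<Union>J \<Longrightarrow> A \<in> J"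
  using arms_eq by blast

lemma arm_partner:
  assumes "x \<in> ground M"
  obtains A y where "A \<in> \<A>" "A = {x, y}" "x \<noteq> y"
proof -
  obtain A where A: "A \<in> \<A>" "x \<in> A" using assms Union_arms by blast
  then obtain a b where "A = {a, b}" "a \<noteq> b" using card_arm card_2_iff by metis
  then show ?thesis using A that by (metis insert_commute insert_iff singletonD)
qed

lemma indep_no_arms: "indep M X \<Longrightarrow> J \<subseteq> \<A> \<Longrightarrow> card J = s \<Longrightarrow> \<not> \<Union>J \<subseteq> X"
  using circuit_arms circuit_not_subset_indep by blast

text \<open>An arm that meets \<open>C\<close> in only one element, joined to \<open>t - 1\<close>
  arms avoided by \<open>C\<close>, would give a cocircuit meeting \<open>C\<close> in one element,
  against orthogonality. Hence \<open>C\<close> is a union of arms, and minimality of circuits fixes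
  their number.\<close>

lemma circuit_avoiding_arms:
  assumes C: "circuit M C" and K: "K \<subseteq> \<A>" "t - 1 \<le> card K" "C \<inter> \<Union>K = {}"
  shows "\<exists>J\<subseteq>\<A>. card J = s \<and> C = \<Union>J"
proof -
  obtain L where L: "L \<subseteq> K" "card L = t - 1" using obtain_subset_with_card_n[OF K(2)] by metis
  have Cg: "C \<subseteq> ground M" using C by (simp add: circuit_def)
  have full: "A \<subseteq> C" if A: "A \<in> \<A>" "c \<in> A" "c \<in> C" for A c
  proof (rule ccontr)
    assume nsub: "\<not> A \<subseteq> C"
    obtain d where d: "A = {c, d}"
    proof -
      have "c \<in> ground M" using A Cg by blast
      then obtain B y where "B \<in> \<A>" "B = {c, y}" by (rule arm_partner)
      then show thesis using that arms_eq[OF A(1), of B c] A(2) by simp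
    qed
    have "A \<notin> L" using A L K by blast
    then have "card (insert A L) = t"
      using L t_pos finite_subset[OF subset_trans[OF L(1) K(1)] finite_arms] by simp
    then have "cocircuit M (\<Union>(insert A L))" using A L K cocircuit_arms by blast
    moreover have "C \<inter> \<Union>(insert A L) = {c}" using A d nsub L K by auto
    ultimately show False using circuit_cocircuit_Int[OF C] by blast
  qed
  define J where "J = {A \<in> \<A>. A \<subseteq> C}"
  have J: "J \<subseteq> \<A>" "C = \<Union>J"
  proof -
    show "J \<subseteq> \<A>" by (auto simp: J_def)
    show "C = \<Union>J"
    proof
      show "C \<subseteq> \<Union>J"
      proof
        fix c assume c: "c \<in> C"
        then obtain A where "A \<in> \<A>" "c \<in> A" using Cg Union_arms by blast
        then show "c \<in> \<Union>J" using full[of A c] c by (auto simp: J_def)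
      qed
    qed (auto simp: J_def)
  qed
  show ?thesis
  \<comment> \<open>With at least \<open>s\<close> arms, \<open>C\<close> contains an
    \<open>s\<close>-arm circuit; with fewer, it is contained in one. Either way the two circuits
    coincide.\<close>
  proof (cases "s \<le> card J")
    case True
    then obtain J' where J': "J' \<subseteq> J" "card J' = s" using obtain_subset_with_card_n by blast
    then have "circuit M (\<Union>J')" using J circuit_arms by blast
    then have "\<Union>J' = C" using circuit_subset_eq C J J' by blast
    moreover have "J' \<subseteq> \<A>" using J(1) J'(1) by (rule subset_trans[rotated])
    ultimately show ?thesis using J'(2) by metis
  next
    case False
    obtain J' where J': "J \<subseteq> J'" "J' \<subseteq> \<A>" "card J' = s"
      using exists_subset_between[of J s \<A>] False J finite_arms card_arms long by auto
    then have "C \<subseteq> \<Union>J'" using J(2) by (simp add: Union_mono)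
    then have "C = \<Union>J'" using circuit_subset_eq[OF C circuit_arms[OF J'(2,3)]] by simp
    then show ?thesis using J' by blast
  qed
qed

text \<open>Fewer than \<open>s\<close> arms of \<open>S\<close> and \<open>T\<close> lie inside the
  independent set \<open>X\<close>, and any other arm must contain \<open>x\<close> or
  \<open>y\<close>. So at most \<open>s + 1\<close> arms are involved, and \<open>C\<close> avoids
  the remaining ones, of which there are at least \<open>t - 1\<close>.\<close>

lemma linear_class:
  assumes X: "indep M X" and S: "S \<subseteq> \<A>" "card S = s" "\<Union>S \<subseteq> insert x X"
    and T: "T \<subseteq> \<A>" "card T = s" "\<Union>T \<subseteq> insert y X"
    and C: "circuit M C" "C \<subseteq> \<Union>S \<union> \<Union>T"
  shows "\<exists>J\<subseteq>\<A>. card J = s \<and> C = \<Union>J"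
proof -
  define U where "U = {A \<in> S \<union> T. A \<subseteq> X}"
  have fin: "finite (S \<union> T)" using S T finite_arms finite_subset by blast
  have "card U < s"
  proof (rule ccontr)
    assume "\<not> card U < s"
    then obtain J where "J \<subseteq> U" "card J = s" using obtain_subset_with_card_n by (metis not_less)
    moreover from this have "J \<subseteq> \<A>" "\<Union>J \<subseteq> X" using S T unfolding U_def by auto
    ultimately show False using indep_no_arms X by blast
  qed
  \<comment> \<open>\<open>A\<close> and \<open>A'\<close> are the arms through \<open>x\<close> and
    \<open>y\<close>; if there is no such arm, the condition is vacuous.\<close>
  obtain A where A: "\<And>B. B \<in> \<A> \<Longrightarrow> x \<in> B \<Longrightarrow> B = A" using arms_eq by metis
  obtain A' where A': "\<And>B. B \<in> \<A> \<Longrightarrow> y \<in> B \<Longrightarrow> B = A'" using arms_eq by metis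
  have "S \<union> T \<subseteq> U \<union> {A, A'}"
  proof
    fix B assume B: "B \<in> S \<union> T"
    then have "B \<in> \<A>" using S T by blast
    then have "B \<subseteq> X" if "B \<noteq> A" "B \<noteq> A'" using that B A A' S(3) T(3) by blast
    then show "B \<in> U \<union> {A, A'}" using B unfolding U_def by blast
  qed
  moreover have "finite (U \<union> {A, A'})" using fin unfolding U_def by simp
  ultimately have "card (S \<union> T) \<le> card (U \<union> {A, A'})" by (rule card_mono[rotated])
  also have "\<dots> \<le> card U + card {A, A'}" by (rule card_Un_le)
  also have "\<dots> \<le> s + 1" using \<open>card U < s\<close> card_insert_le_m1[of 2 "{A'}" A] by simp
  finally have "card (S \<union> T) \<le> s + 1" .
  then have "t - 1 \<le> card (\<A> - (S \<union> T))"
    using S T card_Diff_subset[OF fin] card_arms long by auto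
  moreover have "C \<inter> \<Union>(\<A> - (S \<union> T)) = {}"
  proof -
    have "False" if "z \<in> C" "B \<in> \<A>" "B \<notin> S \<union> T" "z \<in> B" for z B
      using that C(2) S(1) T(1) arm_subset_Union[of B "S \<union> T" z] by blast
    then show ?thesis by blast
  qed
  ultimately show ?thesis using circuit_avoiding_arms[OF C(1), of "\<A> - (S \<union> T)"] by blast
qed

text \<open>This extends \<open>linear_class\<close> from two fundamental circuits to any number of
  them. It is what makes augmentation work in the lift: a circuit none of whose elements can be
  added to \<open>X\<close> already belongs to the class.\<close>

lemma circuit_spanned_by_arms:
  assumes "indep M X" "circuit M C"
    and "\<And>y. y \<in> C - X \<Longrightarrow> \<exists>S\<subseteq>\<A>. card S = s \<and> \<Union>S \<subseteq> insert y X"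
  shows "\<exists>S\<subseteq>\<A>. card S = s \<and> C = \<Union>S"
  using assms
proof (induction "card (C - X)" arbitrary: X rule: less_induct)
  case less
  note X = less.prems(1) and C = less.prems(2)
  obtain a where a: "a \<in> C" "a \<notin> X" using circuit_not_subset_indep X C by blast
  then obtain S where S: "S \<subseteq> \<A>" "card S = s" "\<Union>S \<subseteq> insert a X" using less.prems(3) by blast
  have cS: "circuit M (\<Union>S)" using S circuit_arms by blast
  show ?case
  proof (cases "\<Union>S \<subseteq> C")
    case True
    then show ?thesis using circuit_subset_eq[OF cS C] S by blast
  next
    case False
    then obtain x where x: "x \<in> \<Union>S" "x \<notin> C" by blast
    then have xX: "x \<in> X" "x \<noteq> a" using S a by auto
    \<comment> \<open>Exchanging \<open>x\<close> for \<open>a\<close> keeps the fundamental circuits in the linear class and moves \<open>X\<close>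
      closer to \<open>C\<close>.\<close>
    define X' where "X' = insert a X - {x}"
    have sub: "X' \<subseteq> ground M" using a C indep_subset_ground[OF X] by (auto simp: X'_def circuit_def)
    have iX': "indep M X'"
    proof (rule ccontr)
      assume "\<not> indep M X'"
      then obtain D where D: "D \<subseteq> X'" "circuit M D" using dependent_contains_circuit sub by blast
      then have "D = \<Union>S" using circuit_in_insert_unique[OF X D(2) _ cS S(3)] by (auto simp: X'_def)
      then show False using D x by (auto simp: X'_def)
    qed
    have "C - X' \<subset> C - X" using a x by (auto simp: X'_def)
    moreover have "finite C" using C finite_ground finite_subset by (auto simp: circuit_def)
    ultimately have "card (C - X') < card (C - X)" by (simp add: psubset_card_mono)
    moreover have "\<exists>T\<subseteq>\<A>. card T = s \<and> \<Union>T \<subseteq> insert y X'" if y: "y \<in> C - X'" for y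
    proof -
      have y': "y \<in> C - X" "y \<noteq> a" using y x by (auto simp: X'_def)
      then obtain T where T: "T \<subseteq> \<A>" "card T = s" "\<Union>T \<subseteq> insert y X" using less.prems(3) by blast
      have cT: "circuit M (\<Union>T)" using T circuit_arms by blast
      show ?thesis
      proof (cases "x \<in> \<Union>T")
        case False
        then have "\<Union>T \<subseteq> insert y X'" using T(3) unfolding X'_def by blast
        then show ?thesis using T by blast
      next
        case True
        \<comment> \<open>Circuit elimination of \<open>x\<close>. If \<open>Z\<close> were
          independent, the two circuits would both be the unique circuit in
          \<open>insert x Z\<close>; being equal, they would lie in \<open>X\<close>. So
          \<open>Z\<close> contains a circuit, and \<open>linear_class\<close> makes it the required
          union of arms inside \<open>insert y X'\<close>.\<close>
        define Z where "Z = (\<Union>S \<union> \<Union>T) - {x}"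
        have "\<not> indep M Z"
        proof
          assume Z: "indep M Z"
          have "\<Union>S = \<Union>T"
            by (rule circuit_in_insert_unique[OF Z cS _ cT, of x]) (auto simp: Z_def)
          then have "\<Union>S \<subseteq> X" using S(3) T(3) y' by blast
          then show False using indep_no_arms X S by blast
        qed
        moreover have "Z \<subseteq> ground M" using cS cT by (auto simp: Z_def circuit_def)
        ultimately obtain D where D: "D \<subseteq> Z" "circuit M D" using dependent_contains_circuit by blast
        moreover have "Z \<subseteq> insert y X'" using S(3) T(3) by (auto simp: Z_def X'_def)
        moreover have "\<exists>J\<subseteq>\<A>. card J = s \<and> D = \<Union>J"
          using linear_class[OF X S T D(2)] D(1) by (auto simp: Z_def)
        ultimately show ?thesis by blast
      qed
    qed
    ultimately show ?thesis using less.hyps[OF _ iX' C] by blast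
  qed
qed

section \<open>Augmentation in the lift\<close>

lemma lift_indep_of_indep: "indep M X \<Longrightarrow> lift_indep s \<A> M X"
  unfolding lift_indep_def using indep_no_arms indep_subset_ground
  by (metis Diff_subset indep_subset)

lemma lift_indep_subset: "lift_indep s \<A> M X \<Longrightarrow> Y \<subseteq> X \<Longrightarrow> lift_indep s \<A> M Y"
proof -
  assume X: "lift_indep s \<A> M X" and sub: "Y \<subseteq> X"
  then obtain x where "indep M (X - {x})" by (auto simp: lift_indep_def)
  moreover have "Y - {x} \<subseteq> X - {x}" using sub by blast
  ultimately have "indep M (Y - {x})" by (rule indep_subset)
  then show ?thesis using X sub unfolding lift_indep_def by blast
qed

lemma lift_indep_finite: "lift_indep s \<A> M X \<Longrightarrow> finite X"
  unfolding lift_indep_def using finite_ground finite_subset by blast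

text \<open>A non-strict inequality suffices because the augmentation in \<open>M\<close> starts
  from \<open>X - {x}\<close>, which is smaller than \<open>Y\<close>. The element \<open>y\<close>
  found there keeps the nullity at one, so the circuit inside \<open>X\<close> remains the only one
  in \<open>insert y X\<close>, and it is not a union of \<open>s\<close> arms.\<close>

lemma lift_augment_dependent:
  assumes X: "lift_indep s \<A> M X" "\<not> indep M X" and Y: "indep M Y" "card X \<le> card Y"
  shows "\<exists>y\<in>Y - X. lift_indep s \<A> M (insert y X)"
proof -
  obtain x where x: "indep M (X - {x})" using X by (auto simp: lift_indep_def)
  have xX: "x \<in> X" using x X(2) by (metis Diff_empty Diff_insert0)
  have "card (X - {x}) < card Y" using xX X(1) Y(2) lift_indep_finite by (metis card_Diff1_less less_le_trans)
  then obtain y where y: "y \<in> Y - (X - {x})" "indep M (insert y (X - {x}))"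
    using indep_augment x Y(1) by blast
  have yx: "y \<noteq> x" using y X(2) xX by (metis insert_Diff)
  have XG: "X \<subseteq> ground M" using X(1) by (simp add: lift_indep_def)
  obtain C where C: "C \<subseteq> X" "circuit M C" using dependent_contains_circuit X XG by blast
  have "\<not> \<Union>J \<subseteq> insert y X" if J: "J \<subseteq> \<A>" "card J = s" for J
  proof
    assume "\<Union>J \<subseteq> insert y X"
    then have "\<Union>J = C"
      using circuit_in_insert_unique[OF y(2) circuit_arms[OF J] _ C(2), of x] C(1) by blast
    then show False using X(1) C J by (auto simp: lift_indep_def)
  qed
  moreover have "insert y X - {x} = insert y (X - {x})" using yx by blast
  moreover have "y \<in> ground M" using y Y indep_subset_ground by blast
  ultimately have "lift_indep s \<A> M (insert y X)"
    unfolding lift_indep_def using y(2) XG by (metis insert_subset)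
  then show ?thesis using y yx by blast
qed

text \<open>For dependent \<open>X\<close>, dropping one element of \<open>Y\<close> reduces to
  \<open>lift_augment_dependent\<close>. For independent \<open>X\<close>, failure of augmentation
  means that every element of \<open>Y - X\<close> completes \<open>s\<close> arms with
  \<open>X\<close>; then a circuit inside \<open>Y\<close> is itself a union of \<open>s\<close>
  arms, which \<open>Y\<close> cannot contain.\<close>

lemma lift_augment:
  assumes X: "lift_indep s \<A> M X" and Y: "lift_indep s \<A> M Y" and less: "card X < card Y"
  shows "\<exists>y\<in>Y - X. lift_indep s \<A> M (insert y X)"
proof (cases "indep M X")
  case False
  obtain y where y: "indep M (Y - {y})" using Y by (auto simp: lift_indep_def)
  have "card X \<le> card (Y - {y})" using less by (auto simp: card_Diff_singleton_if)
  then show ?thesis using lift_augment_dependent[OF X False y] by blast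
next
  case True
  show ?thesis
  proof (rule ccontr)
    assume no: "\<not> ?thesis"
    have "\<not> indep M Y" using indep_augment[OF True _ less] no lift_indep_of_indep by blast
    then obtain C where C: "C \<subseteq> Y" "circuit M C"
      using dependent_contains_circuit Y unfolding lift_indep_def by meson
    have "\<exists>S\<subseteq>\<A>. card S = s \<and> \<Union>S \<subseteq> insert y X" if y: "y \<in> C - X" for y
    proof -
      have "\<not> lift_indep s \<A> M (insert y X)" using no y C by blast
      moreover have "insert y X \<subseteq> ground M" using y C X by (auto simp: lift_indep_def circuit_def)
      moreover have "indep M (insert y X - {y})" using y True by simp
      \<comment> \<open>The set \<open>insert y X\<close> has nullity at most one, so only a
        contained union of \<open>s\<close> arms can make it dependent in the lift.\<close>
      ultimately show ?thesis unfolding lift_indep_def by blast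
    qed
    then obtain S where "S \<subseteq> \<A>" "card S = s" "C = \<Union>S"
      using circuit_spanned_by_arms[OF True C(2)] by blast
    then show False using Y C by (auto simp: lift_indep_def)
  qed
qed

lemma matroid_lift: "matroid (lift_matroid s \<A> M)"
proof
  show "indep (lift_matroid s \<A> M) {}"
    using lift_indep_of_indep[OF indep_empty] by (simp add: lift_matroid_def)
next
  fix X Y assume "indep (lift_matroid s \<A> M) X" "Y \<subseteq> X"
  then show "indep (lift_matroid s \<A> M) Y" using lift_indep_subset by (simp add: lift_matroid_def)
next
  fix X Y assume "indep (lift_matroid s \<A> M) X" "indep (lift_matroid s \<A> M) Y" "card X < card Y"
  then show "\<exists>y\<in>Y - X. indep (lift_matroid s \<A> M) (insert y X)"
    using lift_augment by (simp add: lift_matroid_def)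
qed (auto simp: lift_matroid_def lift_indep_def finite_ground)

section \<open>The one-element extension and its contraction\<close>

lemma matroid_lift_ext: "matroid (lift_ext s \<A> M)"
proof
  fix X assume X: "indep (lift_ext s \<A> M) X"
  then have "Some -` X \<subseteq> ground M"
    using indep_subset_ground by (auto simp: lift_ext_def lift_indep_def split: if_splits)
  then show "X \<subseteq> ground (lift_ext s \<A> M)"
    by (auto simp: lift_ext_def) (metis image_eqI not_None_eq subsetD vimageI2)
next
  fix X Y assume "indep (lift_ext s \<A> M) X" "Y \<subseteq> X"
  moreover from this have "Some -` Y \<subseteq> Some -` X" by blast
  ultimately show "indep (lift_ext s \<A> M) Y"
    using lift_indep_subset lift_indep_of_indep indep_subset
    by (auto simp: lift_ext_def split: if_splits)
next
  fix X Y
  assume X: "indep (lift_ext s \<A> M) X" and Y: "indep (lift_ext s \<A> M) Y" and less: "card X < card Y"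
  let ?X = "Some -` X" and ?Y = "Some -` Y"
  have some: "Some -` insert (Some y) X = insert y ?X" for y by auto
  have fin: "finite X" if "indep (lift_ext s \<A> M) X" for X
  proof -
    have fin: "finite (Some -` X)"
      using that finite_indep lift_indep_finite unfolding lift_ext_def by (simp split: if_splits)
    have "X \<subseteq> insert None (Some ` (Some -` X))"
    proof
      fix z assume "z \<in> X"
      then show "z \<in> insert None (Some ` (Some -` X))" by (cases z) auto
    qed
    moreover have "finite (insert None (Some ` (Some -` X)))" using fin by (intro finite.insertI finite_imageI)
    ultimately show ?thesis using finite_subset by blast
  qed
  have card: "card ?X + (if None \<in> X then 1 else 0) < card ?Y + (if None \<in> Y then 1 else 0)"
    using less card_vimage_Some fin X Y by metis
  show "\<exists>y\<in>Y - X. indep (lift_ext s \<A> M) (insert y X)"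
  proof (cases "None \<in> X")
    case True
    then have iX: "indep M ?X" using X by (simp add: lift_ext_def)
    \<comment> \<open>With \<open>None\<close> in \<open>X\<close>, augmentation must take place in
      \<open>M\<close>. If \<open>None\<close> is not in \<open>Y\<close>, then \<open>?Y\<close>
      exceeds \<open>?X\<close> by at least two elements, so it can lose one to become independent
      in \<open>M\<close> and still be larger.\<close>
    obtain Y' where Y': "Y' \<subseteq> ?Y" "indep M Y'" "card ?X < card Y'"
    proof (cases "None \<in> Y")
      case t: True
      then show ?thesis using that[of ?Y] Y card True by (simp add: lift_ext_def)
    next
      case False
      then obtain y where "indep M (?Y - {y})" using Y by (auto simp: lift_ext_def lift_indep_def)
      moreover have "card ?X < card (?Y - {y})"
        using card True False by (auto simp: card_Diff_singleton_if)
      ultimately show ?thesis using that by blast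
    qed
    then obtain y where "y \<in> Y' - ?X" "indep M (insert y ?X)" using indep_augment iX by blast
    then show ?thesis using Y' True some by (intro bexI[of _ "Some y"]) (auto simp: lift_ext_def)
  next
    case False
    then have iX: "lift_indep s \<A> M ?X" using X by (simp add: lift_ext_def)
    have lift: ?thesis if "y \<in> ?Y - ?X" "lift_indep s \<A> M (insert y ?X)" for y
      using that False some by (intro bexI[of _ "Some y"]) (auto simp: lift_ext_def)
    show ?thesis
    proof (cases "None \<in> Y")
      case True
      show ?thesis
      proof (cases "indep M ?X")
        case i: True
        have "Some -` insert None X = ?X" by auto
        then show ?thesis using i True False by (intro bexI[of _ None]) (auto simp: lift_ext_def)
      next
        case d: False
        \<comment> \<open>Here \<open>None\<close> cannot be added, and removing it from
          \<open>Y\<close> costs one element, so only the non-strict inequality survives; this is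
          exactly the case handled by \<open>lift_augment_dependent\<close>.\<close>
        have "indep M ?Y" "card ?X \<le> card ?Y" using True False Y card by (auto simp: lift_ext_def)
        then show ?thesis using lift_augment_dependent[OF iX d] lift by blast
      qed
    next
      case n: False
      then have "lift_indep s \<A> M ?Y" "card ?X < card ?Y"
        using Y card False by (simp_all add: lift_ext_def)
      then show ?thesis using lift_augment[OF iX] lift by blast
    qed
  qed
qed (use indep_empty lift_indep_of_indep finite_ground in \<open>auto simp: lift_ext_def\<close>)

lemma single_element_extension_lift:
  "single_element_extension (relabel Some (lift_matroid s \<A> M)) None (lift_ext s \<A> M)"
proof -
  have "delete (lift_ext s \<A> M) {None} = relabel Some (lift_matroid s \<A> M)"
  proof (rule indep_system.equality)
    show "indep (delete (lift_ext s \<A> M) {None}) = indep (relabel Some (lift_matroid s \<A> M))"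
      by (rule ext) (simp add: indep_relabel_Some delete_def lift_ext_def lift_matroid_def)
  qed (auto simp: delete_def lift_ext_def ground_relabel lift_matroid_def)
  then show ?thesis
    unfolding single_element_extension_def
    using matroid_lift_ext by (auto simp: ground_relabel lift_ext_def lift_matroid_def)
qed

lemma contract_lift_ext: "contract (lift_ext s \<A> M) {None} = relabel Some M"
proof -
  interpret E: matroid "lift_ext s \<A> M" by (rule matroid_lift_ext)
  have ins: "Some -` insert None X = Some -` X" for X :: "'a option set" by auto
  then have "indep (lift_ext s \<A> M) {None}"
    using indep_empty by (simp add: lift_ext_def del: vimage_insert)
  note contr = E.indep_contract_single[OF this]
  show ?thesis
  proof (rule indep_system.equality)
    show "indep (contract (lift_ext s \<A> M) {None}) = indep (relabel Some M)"
      by (rule ext) (simp add: contr indep_relabel_Some, simp add: lift_ext_def ins)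
    show "ground (contract (lift_ext s \<A> M) {None}) = ground (relabel Some M)"
      unfolding ground_relabel
      by (auto simp: contract_def dual_matroid_def delete_def lift_ext_def)
  qed auto
qed

section \<open>The lift as a spike with \<open>t\<close> lowered by one\<close>

lemma lift_indep_avoiding_arms:
  assumes X: "lift_indep s \<A> M X" and K: "K \<subseteq> \<A>" "card K = t - 1" "X \<inter> \<Union>K = {}"
  shows "indep M X"
proof (rule ccontr)
  assume "\<not> indep M X"
  then obtain C where C: "C \<subseteq> X" "circuit M C"
    using dependent_contains_circuit X unfolding lift_indep_def by meson
  \<comment> \<open>Avoiding \<open>t - 1\<close> arms forces \<open>C\<close> to be a union of
    \<open>s\<close> arms, which \<open>X\<close> excludes. Thus the lift and \<open>M\<close> agree
    off any \<open>t - 1\<close> arms, which later yields both the cocircuits of the lift and the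
    closure condition.\<close>
  then have "C \<inter> \<Union>K = {}" using K by blast
  then obtain J where "J \<subseteq> \<A>" "card J = s" "C = \<Union>J"
    using circuit_avoiding_arms[OF C(2) K(1)] K(2) by (metis order_refl)
  then show False using X C by (auto simp: lift_indep_def)
qed

text \<open>One new element raises the nullity to at most one, and it cannot complete
  \<open>s\<close> arms because its own arm stays incomplete.\<close>

lemma lift_indep_insert:
  assumes B: "indep M B" and A: "A \<in> \<A>" "x \<in> A" "\<not> A \<subseteq> insert x B"
  shows "lift_indep s \<A> M (insert x B)"
proof -
  have "\<not> \<Union>J \<subseteq> insert x B" if J: "J \<subseteq> \<A>" "card J = s" for J
  proof
    assume sub: "\<Union>J \<subseteq> insert x B"
    then have "A \<notin> J" using A by blast
    then have "x \<notin> \<Union>J" using arm_subset_Union A J by blast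
    then show False using sub indep_no_arms B J by blast
  qed
  moreover have "indep M (insert x B - {x})" by (rule indep_subset[OF B]) blast
  moreover have "insert x B \<subseteq> ground M" using indep_subset_ground[OF B] A Union_arms by blast
  ultimately show ?thesis unfolding lift_indep_def by blast
qed

text \<open>A basis of the lift avoiding \<open>K\<close> would be independent in \<open>M\<close>
  and could still receive an element of \<open>K\<close>, so every basis of the lift meets
  \<open>K\<close>. Conversely \<open>K\<close> is properly contained in a \<open>t\<close>-arm
  cocircuit of \<open>M\<close>, so some basis of \<open>M\<close> misses it; adding any one
  \<open>x\<close> of \<open>K\<close> gives a basis of the lift that meets \<open>K\<close> only in
  \<open>x\<close>.\<close>

lemma lift_cocircuit_arms:
  assumes t: "2 \<le> t" and K: "K \<subseteq> \<A>" "card K = t - 1"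
  shows "cocircuit (lift_matroid s \<A> M) (\<Union>K)"
proof -
  interpret N: matroid "lift_matroid s \<A> M" by (rule matroid_lift)
  have sel: "indep (lift_matroid s \<A> M) X = lift_indep s \<A> M X"
    "ground (lift_matroid s \<A> M) = ground M" for X by (simp_all add: lift_matroid_def)
  have KG: "\<Union>K \<subseteq> ground M" using K Union_arms by blast
  have partner: "\<exists>A y. A \<in> K \<and> A = {x, y} \<and> x \<noteq> y" if x: "x \<in> \<Union>K" for x
  proof -
    obtain A y where "A \<in> \<A>" "A = {x, y}" "x \<noteq> y" using arm_partner x KG by blast
    moreover from this have "A \<in> K" using arm_subset_Union K x by blast
    ultimately show ?thesis by blast
  qed
  have dep: "\<not> indep (dual_matroid (lift_matroid s \<A> M)) (\<Union>K)"
  proof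
    assume "indep (dual_matroid (lift_matroid s \<A> M)) (\<Union>K)"
    then obtain B where B: "basis (lift_matroid s \<A> M) B" "\<Union>K \<inter> B = {}"
      by (auto simp: N.indep_dual_iff)
    then have "lift_indep s \<A> M B" by (simp add: basis_def sel)
    then have iB: "indep M B" using lift_indep_avoiding_arms K B by blast
    have "K \<noteq> {}" using K t by auto
    then obtain A where "A \<in> K" by blast
    then obtain x where "x \<in> A" using arm_nonempty K by blast
    then have "x \<in> \<Union>K" using \<open>A \<in> K\<close> by blast
    then obtain A y where A: "A \<in> K" "A = {x, y}" "x \<noteq> y" using partner by blast
    then have "x \<notin> B" "\<not> A \<subseteq> insert x B" using B by auto
    then have "lift_indep s \<A> M (insert x B)" using lift_indep_insert[OF iB, of A x] A K by blast
    then have "insert x B = B" using B by (auto simp: basis_def sel)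
    then show False using \<open>x \<notin> B\<close> by blast
  qed
  have del: "indep (dual_matroid (lift_matroid s \<A> M)) (\<Union>K - {x})" if x: "x \<in> \<Union>K" for x
  proof -
    obtain L where L: "K \<subseteq> L" "L \<subseteq> \<A>" "card L = t"
      using exists_subset_between[of K t \<A>] K finite_arms card_arms long by auto
    have "\<Union>K \<noteq> \<Union>L"
    proof
      assume eq: "\<Union>K = \<Union>L"
      have "A \<in> K" if "A \<in> L" for A
        using that arm_nonempty arm_subset_Union[of A K] K L eq by blast
      then have "K = L" using L by blast
      then show False using K L t by simp
    qed
    then have "\<Union>K \<subset> \<Union>L" using L by blast
    then have "indep (dual_matroid M) (\<Union>K)"
      using cocircuit_arms[OF L(2,3)] by (auto simp: cocircuit_def circuit_def)
    then obtain B where B: "basis M B" "\<Union>K \<inter> B = {}" by (auto simp: indep_dual_iff)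
    then have xB: "x \<notin> B" using x by blast
    obtain A y where A: "A \<in> K" "A = {x, y}" "x \<noteq> y" using partner x by blast
    then have "\<not> A \<subseteq> insert x B" using B by auto
    then have ind: "lift_indep s \<A> M (insert x B)"
      using lift_indep_insert[OF basis_indep[OF B(1)], of A x] A K by blast
    have "basis (lift_matroid s \<A> M) (insert x B)"
    \<comment> \<open>The lift has rank at most one more than \<open>M\<close>, since deleting one
      suitable element leaves a set independent in \<open>M\<close>; \<open>insert x B\<close>
      attains this bound.\<close>
    proof (rule N.basisI_card)
      show "indep (lift_matroid s \<A> M) (insert x B)" using ind by (simp add: sel)
      fix I assume "indep (lift_matroid s \<A> M) I"
      then obtain z where "indep M (I - {z})" by (auto simp: sel lift_indep_def)
      then have "card (I - {z}) \<le> card B" using card_indep_le_basis B by blast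
      moreover have "card (insert x B) = Suc (card B)"
        using xB finite_indep[OF basis_indep[OF B(1)]] by simp
      ultimately show "card I \<le> card (insert x B)" by (simp add: card_Diff_singleton_if split: if_splits)
    qed
    moreover have "(\<Union>K - {x}) \<inter> insert x B = {}" using B by blast
    ultimately show ?thesis using KG by (auto simp: N.indep_dual_iff sel)
  qed
  interpret D: matroid "dual_matroid (lift_matroid s \<A> M)" by (rule N.matroid_dual)
  have "indep (dual_matroid (lift_matroid s \<A> M)) X" if X: "X \<subset> \<Union>K" for X
  proof -
    obtain x where "x \<in> \<Union>K" "X \<subseteq> \<Union>K - {x}" using X by blast
    then show ?thesis using del D.indep_subset by blast
  qed
  then show ?thesis unfolding cocircuit_def circuit_def using dep KG by (simp add: N.ground_dual sel)
qed

lemma lift_circuit_arms: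
  assumes J: "J \<subseteq> \<A>" "card J = s"
  shows "circuit (lift_matroid s \<A> M) (\<Union>J)"
proof -
  have "lift_indep s \<A> M D" if "D \<subset> \<Union>J" for D
    using that circuit_arms[OF J] lift_indep_of_indep by (auto simp: circuit_def)
  moreover have "\<not> lift_indep s \<A> M (\<Union>J)" using J by (auto simp: lift_indep_def)
  moreover have "\<Union>J \<subseteq> ground M" using J Union_arms by blast
  ultimately show ?thesis by (simp add: circuit_def lift_matroid_def)
qed

lemma spike_lift:
  assumes t: "2 \<le> t"
  shows "spike s (t - 1) m \<A> (lift_matroid s \<A> M)"
proof -
  have "ground (lift_matroid s \<A> M) = ground M" by (simp add: lift_matroid_def)
  then show ?thesis
    unfolding spike_def
    using matroid_lift lift_cocircuit_arms[OF t] lift_circuit_arms s_pos t long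
      arms_partition card_arms card_arm by auto
qed

text \<open>The witness is \<open>lift_ext\<close>. Off \<open>t - 1\<close> arms, sets independent
  in the lift are independent in \<open>M\<close>, hence stay independent when \<open>None\<close>
  is added; so \<open>None\<close> raises the rank and lies outside the closure.\<close>

lemma quotient_step_lift:
  assumes t: "2 \<le> t"
  shows "quotient_step_wrt s (t - 1) m \<A> (lift_matroid s \<A> M) M"
proof -
  interpret E: matroid "lift_ext s \<A> M" by (rule matroid_lift_ext)
  have "None \<notin> mclosure (lift_ext s \<A> M) (Some ` (ground M - \<Union>K))"
    if K: "K \<subseteq> \<A>" "card K = t - 1" for K
  proof -
    let ?X = "Some ` (ground M - \<Union>K)"
    have "mrank (lift_ext s \<A> M) ?X < mrank (lift_ext s \<A> M) (insert None ?X)"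
    proof (rule E.mrank_less_insert)
      show "?X \<subseteq> ground (lift_ext s \<A> M)" by (auto simp: lift_ext_def)
      show "None \<notin> ?X" by blast
      fix I assume I: "I \<subseteq> ?X" "indep (lift_ext s \<A> M) I"
      then have "None \<notin> I" by blast
      then have l: "lift_indep s \<A> M (Some -` I)" using I by (simp add: lift_ext_def)
      have "Some -` I \<inter> \<Union>K = {}" using I(1) by auto
      then have "indep M (Some -` I)" using lift_indep_avoiding_arms l K by blast
      moreover have "Some -` insert None I = Some -` I" by auto
      ultimately show "indep (lift_ext s \<A> M) (insert None I)" by (simp add: lift_ext_def)
    qed
    then show ?thesis by (simp add: mclosure_def)
  qed
  moreover have "ground (lift_matroid s \<A> M) = ground M" by (simp add: lift_matroid_def)
  ultimately show ?thesis
    unfolding quotient_step_wrt_def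
    using spike_lift[OF t] long single_element_extension_lift contract_lift_ext[symmetric]
    by (intro conjI exI[of _ "lift_ext s \<A> M"]) auto
qed

end

section \<open>Steps between spikes\<close>

lemma spike_from_quotient_step:
  assumes "spike s (Suc t) m \<A> M" "1 \<le> t" "s + Suc t \<le> m"
  shows "\<exists>N. spike s t m \<A> N \<and> quotient_step_wrt s t m \<A> N M"
proof -
  interpret matroid M using assms(1) by (simp add: spike_def)
  interpret long_spike M s "Suc t" m \<A> by unfold_locales (use assms in auto)
  show ?thesis using spike_lift quotient_step_lift assms(2) by auto
qed

lemma spike_dual:
  assumes "spike s t m \<A> M"
  shows "spike t s m \<A> (dual_matroid M)"
proof -
  interpret matroid M using assms by (simp add: spike_def)
  show ?thesis using assms matroid_dual by (auto simp: spike_def ground_dual cocircuit_def dual_dual)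
qed

text \<open>A quotient step is peeled off the dual of \<open>M\<close>, which exchanges the roles of
  \<open>s\<close> and \<open>t\<close>; the dual of the spike found there is the predecessor of
  \<open>M\<close>.\<close>

lemma spike_from_dual_step:
  assumes "spike (Suc s) t m \<A> M" "1 \<le> s" "Suc s + t \<le> m"
  shows "\<exists>N. spike s t m \<A> N \<and> dual_step N M"
proof -
  interpret matroid M using assms by (simp add: spike_def)
  obtain N where N: "spike t s m \<A> N" "quotient_step_wrt t s m \<A> N (dual_matroid M)"
    using spike_from_quotient_step[OF spike_dual[OF assms(1)]] assms by auto
  interpret N: matroid N using N by (simp add: spike_def)
  \<comment> \<open>The intermediate matroid is the dual of \<open>M\<close>; double duality
    identifies the source of its quotient step with \<open>N\<close> and its own dual with
    \<open>M\<close>.\<close>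
  have "dual_step (dual_matroid N) M"
    unfolding dual_step_def using spike_dual[OF N(1)] N assms dual_dual N.dual_dual
    by (intro exI[of _ s] exI[of _ t] exI[of _ m] exI[of _ \<A>] exI[of _ "dual_matroid M"]) auto
  then show ?thesis using spike_dual[OF N(1)] by blast
qed

section \<open>Assembling the sequence of steps\<close>

lemma quotient_sequence:
  assumes "spike s (Suc t) m \<A> M" "s + Suc t \<le> m"
  shows "\<exists>Ms. (\<forall>i\<le>t. matroid (Ms i)) \<and> Ms t = M \<and> spike s 1 m \<A> (Ms 0) \<and>
    (\<forall>i\<in>{1..t}. quotient_step (Ms (i - 1)) (Ms i))"
  using assms
proof (induction t arbitrary: M)
  case 0
  then show ?case by (intro exI[of _ "\<lambda>_. M"]) (auto simp: spike_def)
next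
  case (Suc t)
  then obtain N where N: "spike s (Suc t) m \<A> N" "quotient_step_wrt s (Suc t) m \<A> N M"
    using spike_from_quotient_step[of s "Suc t" m \<A> M] by auto
  then have "quotient_step N M" unfolding quotient_step_def by blast
  note N = N(1) this
  then obtain Ms where Ms: "\<forall>i\<le>t. matroid (Ms i)" "Ms t = N" "spike s 1 m \<A> (Ms 0)"
    "\<forall>i\<in>{1..t}. quotient_step (Ms (i - 1)) (Ms i)"
    using Suc.IH[of N] Suc.prems by auto
  have "matroid M" using Suc.prems by (simp add: spike_def)
  then show ?case using Ms N
    \<comment> \<open>The sequence is built from its end: the induction hypothesis supplies one
      ending in the predecessor \<open>N\<close>, and \<open>M\<close> is appended at the next
      index.\<close>
    by (intro exI[of _ "Ms(Suc t := M)"]) (auto simp: le_Suc_eq)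
qed

lemma spike_sequence:
  assumes "spike (Suc s) (Suc t) m \<A> M" "Suc s + Suc t \<le> m"
  shows "\<exists>Ms. (\<forall>i\<le>s + t. matroid (Ms i)) \<and> Ms (s + t) = M \<and> spike 1 1 m \<A> (Ms 0) \<and>
    (\<forall>i\<in>{1..t}. quotient_step (Ms (i - 1)) (Ms i)) \<and>
    (\<forall>i\<in>{Suc t..s + t}. dual_step (Ms (i - 1)) (Ms i))"
  using assms
proof (induction s arbitrary: M)
  case 0
  \<comment> \<open>All dual steps have been peeled off, so their index range is empty and only
    quotient steps remain.\<close>
  then show ?case using quotient_sequence[of 1 t m \<A> M] by simp
next
  case (Suc s)
  then obtain N where N: "spike (Suc s) (Suc t) m \<A> N" "dual_step N M"
    using spike_from_dual_step[of "Suc s" "Suc t" m \<A> M] by auto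
  then obtain Ms where Ms: "\<forall>i\<le>s + t. matroid (Ms i)" "Ms (s + t) = N" "spike 1 1 m \<A> (Ms 0)"
    "\<forall>i\<in>{1..t}. quotient_step (Ms (i - 1)) (Ms i)"
    "\<forall>i\<in>{Suc t..s + t}. dual_step (Ms (i - 1)) (Ms i)"
    using Suc.IH[of N] Suc.prems by auto
  have "matroid M" using Suc.prems by (simp add: spike_def)
  then show ?case using Ms N
    by (intro exI[of _ "Ms(Suc (s + t) := M)"]) (auto simp: le_Suc_eq)
qed

theorem theorem5p11:
  fixes s t m :: nat and \<A> :: "'a set set" and M :: "'a indep_system"
  assumes "s \<ge> 1" and "t \<ge> 1"
    and "spike s t m \<A> M" and "m \<ge> s + t"
  shows "\<exists>Ms :: nat \<Rightarrow> 'a indep_system.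
    (\<forall>i\<in>{0..s + t - 2}. matroid (Ms i)) \<and>
    Ms (s + t - 2) = M \<and>
    (\<exists>\<A>\<^sub>0. spike 1 1 m \<A>\<^sub>0 (Ms 0)) \<and>
    (\<forall>i\<in>{1..t - 1}. quotient_step (Ms (i - 1)) (Ms i)) \<and>
    (\<forall>i\<in>{t..s + t - 2}. dual_step (Ms (i - 1)) (Ms i))"
proof -
  \<comment> \<open>Writing both parameters as successors turns the truncated differences
    \<open>t - 1\<close> and \<open>s + t - 2\<close> into \<open>t'\<close> and
    \<open>s' + t'\<close>.\<close>
  obtain s' t' where "s = Suc s'" "t = Suc t'"
    using assms(1,2) by (metis Suc_le_D One_nat_def)
  moreover from this obtain Ms where "\<forall>i\<le>s' + t'. matroid (Ms i)" "Ms (s' + t') = M"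
    "spike 1 1 m \<A> (Ms 0)" "\<forall>i\<in>{1..t'}. quotient_step (Ms (i - 1)) (Ms i)"
    "\<forall>i\<in>{Suc t'..s' + t'}. dual_step (Ms (i - 1)) (Ms i)"
    using spike_sequence[of s' t' m \<A> M] assms(3,4) by auto
  ultimately show ?thesis by (intro exI[of _ Ms]) auto
qed

end
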